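(* Let $\Gamma=(V,E)$ be a finite, connected, undirected graph with $|V|\ge 2$ (loops and multiple edges allowed) of degree bounded by $k$, and let $1\le p<\infty$. Then for every $0<\epsilon<1$, $$\lambda_1^{(p)}(\Gamma)\le C\left(\frac{c_{(p)}(\Gamma)}{\delta(\Gamma)}\right)^{p},\qquad\text{where } C=C(k,\epsilon,\rho_\epsilon,p)=\frac{k}{1-\epsilon}\left(\frac{2}{\rho_\epsilon(\Gamma)}\right)^p ,$$ the right-hand side being interpreted as $+\infty$ if $\rho_\epsilon(\Gamma)=0$.
   Context: For a graph $\Gamma=(V,E)$, $x\sim y$ means that the vertices $x,y$ are joined by an edge, and $\omega(x,y)$ is the number of edges joining $x$ and $y$. The degree of $x$ is $\sum_{y\sim x}\omega(x,y)$; degree bounded by $k$ means every vertex has degree at most $k$. The vertex set $V$ carries the combinatorial (shortest path) metric $d$, and $\delta(\cdot)$ denotes the diameter of a finite metric space or of a subset of it; $\delta(\Gamma)=\delta(V)$. $p$-spectral gap: for $1\le p<\infty$, $$\lambda_1^{(p)}(\Gamma)=\inf_f \frac{\sum_{x\in V}\sum_{y\sim x}|f(x)-f(y)|^p\,\omega(x,y)}{\inf_{\alpha\in\mathbb{R}}\sum_{x\in V}|f(x)-\alpha|^p},$$ the infimum being over all non-constant $f:V\to\mathbb{R}$ (in $\sum_{y\sim x}$ each neighbouring vertex $y$ is counted once). $\ell_p$-distortion: for a finite metric space $X$ with at least two points, $c_{(p)}(X)=\inf_f L_f$, where the infimum is over all one-to-one maps $f:X\to\ell_p(\mathbb{N})$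 (real $\ell_p$) that are 1-Lipschitz, i.e. $\|f(x)-f(y)\|_p\le d(x,y)$ for all $x,y$, and $L_f=\max_{x\ne y}\frac{d(x,y)}{\|f(x)-f(y)\|_p}$. Write $c_{(p)}(\Gamma)=c_{(p)}(V)$. Volume distribution: for $0<\epsilon<1$, $\rho_\epsilon(X)=\min\{\delta(A)/\delta(X): A\subseteq X,\ |A|\ge\epsilon|X|\}$, and $\rho_\epsilon(\Gamma)=\rho_\epsilon(V)$. *)

theory Defs
  imports Complex_Main "HOL-Library.Extended_Real"
begin

text \<open>
  Undirected multigraphs. The function \<open>ends\<close> sends an edge to its set of end points; this set has
  two elements for a proper edge and one element for a loop.
\<close>

record ('v, 'e) multigraph =
  verts :: "'v set"
  edges :: "'e set"
  ends :: "'e \<Rightarrow> 'v set"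

definition finite_multigraph :: "('v, 'e) multigraph \<Rightarrow> bool" where
  "finite_multigraph G \<longleftrightarrow> finite (verts G) \<and> finite (edges G) \<and>
     (\<forall>e\<in>edges G. ends G e \<subseteq> verts G \<and> card (ends G e) \<in> {1, 2})"

definition adjacent :: "('v, 'e) multigraph \<Rightarrow> 'v \<Rightarrow> 'v \<Rightarrow> bool" where
  "adjacent G x y \<longleftrightarrow> (\<exists>e\<in>edges G. ends G e = {x, y})"

definition edge_mult :: "('v, 'e) multigraph \<Rightarrow> 'v \<Rightarrow> 'v \<Rightarrow> nat" where
  "edge_mult G x y = card {e \<in> edges G. ends G e = {x, y}}"

text \<open>A loop at \<open>x\<close> contributes 1, not 2, to the degree of \<open>x\<close>.\<close>

definition vertex_degree :: "('v, 'e) multigraph \<Rightarrow> 'v \<Rightarrow> nat" where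
  "vertex_degree G x = (\<Sum>y | adjacent G x y. edge_mult G x y)"

definition connected_graph :: "('v, 'e) multigraph \<Rightarrow> bool" where
  "connected_graph G \<longleftrightarrow> (\<forall>x\<in>verts G. \<forall>y\<in>verts G. \<exists>n. (adjacent G ^^ n) x y)"

definition graph_dist :: "('v, 'e) multigraph \<Rightarrow> 'v \<Rightarrow> 'v \<Rightarrow> real" where
  "graph_dist G x y = real (LEAST n. (adjacent G ^^ n) x y)"

definition spectral_gap :: "real \<Rightarrow> ('v, 'e) multigraph \<Rightarrow> real" where
  "spectral_gap p G =
     (INF f \<in> {f :: 'v \<Rightarrow> real. \<exists>x\<in>verts G. \<exists>y\<in>verts G. f x \<noteq> f y}.
        (\<Sum>x\<in>verts G. \<Sum>y | adjacent G x y. \<bar>f x - f y\<bar> powr p * real (edge_mult G x y)) /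
        (INF \<alpha>\<in>(UNIV :: real set). \<Sum>x\<in>verts G. \<bar>f x - \<alpha>\<bar> powr p))"

text \<open>
  Finite metric spaces are given by a carrier \<open>X\<close> and a distance function \<open>d\<close>. The maxima and
  minima below range over nonempty finite sets as soon as \<open>X\<close> is finite (with at least two points
  in the case of \<open>expansion\<close>) and \<open>A\<close> is nonempty.
\<close>

definition diam :: "('a \<Rightarrow> 'a \<Rightarrow> real) \<Rightarrow> 'a set \<Rightarrow> real" where
  "diam d A = Max {d x y | x y. x \<in> A \<and> y \<in> A}"

definition volume_distribution :: "real \<Rightarrow> 'a set \<Rightarrow> ('a \<Rightarrow> 'a \<Rightarrow> real) \<Rightarrow> real" where
  "volume_distribution \<epsilon> X d =
     Min {diam d A / diam d X | A. A \<subseteq> X \<and> real (card A) \<ge> \<epsilon> * real (card X)}"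

definition lp_space :: "real \<Rightarrow> (nat \<Rightarrow> real) set" where
  "lp_space p = {u. summable (\<lambda>n. \<bar>u n\<bar> powr p)}"

definition lp_norm :: "real \<Rightarrow> (nat \<Rightarrow> real) \<Rightarrow> real" where
  "lp_norm p u = (\<Sum>n. \<bar>u n\<bar> powr p) powr (1 / p)"

definition lp_dist :: "real \<Rightarrow> (nat \<Rightarrow> real) \<Rightarrow> (nat \<Rightarrow> real) \<Rightarrow> real" where
  "lp_dist p u v = lp_norm p (\<lambda>n. u n - v n)"

definition lp_embeddings :: "real \<Rightarrow> 'a set \<Rightarrow> ('a \<Rightarrow> 'a \<Rightarrow> real) \<Rightarrow> ('a \<Rightarrow> nat \<Rightarrow> real) set" where
  "lp_embeddings p X d =
     {f. f ` X \<subseteq> lp_space p \<and> inj_on f X \<and> (\<forall>x\<in>X. \<forall>y\<in>X. lp_dist p (f x) (f y) \<le> d x y)}"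

definition expansion :: "real \<Rightarrow> 'a set \<Rightarrow> ('a \<Rightarrow> 'a \<Rightarrow> real) \<Rightarrow> ('a \<Rightarrow> nat \<Rightarrow> real) \<Rightarrow> real" where
  "expansion p X d f = Max {d x y / lp_dist p (f x) (f y) | x y. x \<in> X \<and> y \<in> X \<and> x \<noteq> y}"

definition lp_distortion :: "real \<Rightarrow> 'a set \<Rightarrow> ('a \<Rightarrow> 'a \<Rightarrow> real) \<Rightarrow> real" where
  "lp_distortion p X d = (INF f \<in> lp_embeddings p X d. expansion p X d f)"

definition graph_diam :: "('v, 'e) multigraph \<Rightarrow> real" where
  "graph_diam G = diam (graph_dist G) (verts G)"

definition graph_volume_distribution :: "real \<Rightarrow> ('v, 'e) multigraph \<Rightarrow> real" where
  "graph_volume_distribution \<epsilon> G = volume_distribution \<epsilon> (verts G) (graph_dist G)"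

definition graph_lp_distortion :: "real \<Rightarrow> ('v, 'e) multigraph \<Rightarrow> real" where
  "graph_lp_distortion p G = lp_distortion p (verts G) (graph_dist G)"

definition gap_constant :: "real \<Rightarrow> real \<Rightarrow> real \<Rightarrow> real \<Rightarrow> real" where
  "gap_constant k \<epsilon> \<rho> p = k / (1 - \<epsilon>) * (2 / \<rho>) powr p"

end

theory Submission
  imports Defs "HOL-Analysis.Convex"
begin

text \<open>
  Apply the Poincare inequality that defines \<open>\<lambda> = spectral_gap p G\<close> to every coordinate of a
  1-Lipschitz embedding \<open>F\<close> of the vertices into \<open>\<ell>\<^sub>p\<close>, and add up. Because the \<open>p\<close>-th power of the
  \<open>\<ell>\<^sub>p\<close> norm is the sum of the \<open>p\<close>-th powers of the coordinates, the result is a Poincare inequality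
  for \<open>F\<close> itself, with some sequence \<open>a\<close> in the role of the mean (\<open>lp_poincare\<close>). Adjacent vertices
  have images at distance at most 1, so its right-hand side is at most \<open>k n\<close>, where \<open>n\<close> is the
  number of vertices, and if \<open>\<lambda> > 0\<close> the mean of \<open>\<parallel>F x - a\<parallel>\<^sup>p\<close> over all vertices \<open>x\<close> is at most \<open>k / \<lambda>\<close>.

  By Markov's inequality at least \<open>\<epsilon> n\<close> of the vertices satisfy
  \<open>\<parallel>F x - a\<parallel>\<^sup>p \<le> k / (\<lambda> (1 - \<epsilon>))\<close>; let \<open>A\<close> be the set of these
  (\<open>many_vertices_near_centre\<close>). The image of \<open>A\<close> has diameter at most
  \<open>R = 2 (k / (\<lambda> (1 - \<epsilon>)))\<^bsup>1/p\<^esup>\<close>. An expansion \<open>L\<close> of \<open>F\<close> thus gives \<open>diam A \<le> L R\<close>, whereas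
  \<open>diam A \<ge> \<rho> \<delta>\<close>, where \<open>\<delta>\<close> is the diameter of the graph, because \<open>A\<close> is large. So
  \<open>\<rho> \<delta> \<le> L R\<close> for every embedding, hence also with the distortion instead of \<open>L\<close>, and solving
  for \<open>\<lambda>\<close> gives the bound.
\<close>

section \<open>Sequences with summable powers\<close>

text \<open>
  Convexity of \<open>t \<mapsto> t\<^sup>p\<close> at the midpoint. Summed over coordinates it bounds the distance of two points
  of a ball by twice the radius with no loss in the constant, which is all that is needed of
  Minkowski's inequality below.
\<close>

lemma abs_diff_powr_le:
  fixes a b p :: real
  assumes "1 \<le> p"
  shows "\<bar>a - b\<bar> powr p \<le> 2 powr (p - 1) * (\<bar>a\<bar> powr p + \<bar>b\<bar> powr p)"
proof -
  have pw: "2 powr (p - 1) = 2 powr p / (2::real)"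
    by (simp add: powr_diff)
  have ge1: "2 powr (p - 1) \<ge> (1::real)"
    using assms by (simp add: ge_one_powr_ge_zero)
  have *: "(s + t) powr p \<le> 2 powr (p - 1) * (s powr p + t powr p)"
    if "0 \<le> s" "0 \<le> t" for s t :: real
  proof (cases "s = 0 \<or> t = 0")
    case True
    then show ?thesis
      using mult_right_mono[OF ge1, of "s powr p"] mult_right_mono[OF ge1, of "t powr p"] assms by auto
  next
    case False
    with that have st: "0 < s" "0 < t" by auto
    have mid: "(1 - 1/2) *\<^sub>R s + (1/2) *\<^sub>R t = (s + t) / 2"
      by simp
    have "(s + t) powr p = 2 powr p * ((s + t) / 2) powr p"
      using st by (simp add: powr_divide)
    also have "\<dots> \<le> 2 powr p * ((1 - 1/2) * s powr p + 1/2 * t powr p)"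
      using convex_onD[OF powr_convex[OF assms], of "1/2" s t] st unfolding mid
      by (intro mult_left_mono) auto
    also have "\<dots> = 2 powr (p - 1) * (s powr p + t powr p)"
      unfolding pw by argo
    finally show ?thesis .
  qed
  have "\<bar>a - b\<bar> powr p \<le> (\<bar>a\<bar> + \<bar>b\<bar>) powr p"
    using assms by (intro powr_mono2) auto
  also have "\<dots> \<le> 2 powr (p - 1) * (\<bar>a\<bar> powr p + \<bar>b\<bar> powr p)"
    by (rule *) auto
  finally show ?thesis .
qed

lemma summable_abs_diff_powr:
  fixes u v :: "nat \<Rightarrow> real"
  assumes "1 \<le> p" "summable (\<lambda>n. \<bar>u n\<bar> powr p)" "summable (\<lambda>n. \<bar>v n\<bar> powr p)"
  shows "summable (\<lambda>n. \<bar>u n - v n\<bar> powr p)"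
proof (rule summable_comparison_test')
  show "summable (\<lambda>n. 2 powr (p - 1) * (\<bar>u n\<bar> powr p + \<bar>v n\<bar> powr p))"
    using assms by (intro summable_mult summable_add)
  show "norm (\<bar>u n - v n\<bar> powr p) \<le> 2 powr (p - 1) * (\<bar>u n\<bar> powr p + \<bar>v n\<bar> powr p)"
    if "n \<ge> 0" for n
    using abs_diff_powr_le[OF assms(1), of "u n" "v n"] by simp
qed

lemma lp_dist_powr:
  assumes "1 \<le> p" "u \<in> lp_space p" "v \<in> lp_space p"
  shows "lp_dist p u v powr p = (\<Sum>n. \<bar>u n - v n\<bar> powr p)"
proof -
  have "(\<Sum>n. \<bar>u n - v n\<bar> powr p) \<ge> 0"
    using assms by (intro suminf_nonneg summable_abs_diff_powr) (auto simp: lp_space_def)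
  then show ?thesis
    using assms(1) by (simp add: lp_dist_def lp_norm_def powr_powr)
qed

lemma lp_dist_nonneg: "0 \<le> lp_dist p u v"
  by (simp add: lp_dist_def lp_norm_def)

lemma lp_dist_pos:
  assumes "1 \<le> p" "u \<in> lp_space p" "v \<in> lp_space p" "u \<noteq> v"
  shows "0 < lp_dist p u v"
proof -
  obtain i where "u i \<noteq> v i"
    using assms(4) by auto
  then have "0 < (\<Sum>n. \<bar>u n - v n\<bar> powr p)"
    using assms
    by (intro suminf_pos2[of _ i] summable_abs_diff_powr) (auto simp: lp_space_def)
  then show ?thesis
    by (simp add: lp_dist_def lp_norm_def)
qed

text \<open>
  The centre \<open>a\<close> is any sequence: only its differences with \<open>u\<close> and \<open>v\<close> have to be in \<open>\<ell>\<^sub>p\<close>.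
\<close>

lemma lp_dist_le_twice_radius:
  assumes p: "1 \<le> p"
    and su: "summable (\<lambda>n. \<bar>u n - a n\<bar> powr p)" and u: "(\<Sum>n. \<bar>u n - a n\<bar> powr p) \<le> T"
    and sv: "summable (\<lambda>n. \<bar>v n - a n\<bar> powr p)" and v: "(\<Sum>n. \<bar>v n - a n\<bar> powr p) \<le> T"
  shows "lp_dist p u v \<le> 2 * T powr (1 / p)"
proof -
  have suv: "summable (\<lambda>n. \<bar>u n - v n\<bar> powr p)"
    using summable_abs_diff_powr[OF p su sv] by simp
  have T: "0 \<le> T"
    using suminf_nonneg[OF su] u by simp
  have "(\<Sum>n. \<bar>u n - v n\<bar> powr p)
      \<le> (\<Sum>n. 2 powr (p - 1) * (\<bar>u n - a n\<bar> powr p + \<bar>v n - a n\<bar> powr p))"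
  proof (intro suminf_le suv summable_mult summable_add su sv)
    show "\<bar>u n - v n\<bar> powr p
        \<le> 2 powr (p - 1) * (\<bar>u n - a n\<bar> powr p + \<bar>v n - a n\<bar> powr p)" for n
      using abs_diff_powr_le[OF p, of "u n - a n" "v n - a n"] by simp
  qed
  also have "\<dots> = 2 powr (p - 1) *
      ((\<Sum>n. \<bar>u n - a n\<bar> powr p) + (\<Sum>n. \<bar>v n - a n\<bar> powr p))"
    by (simp add: suminf_mult suminf_add[OF su sv] summable_add[OF su sv])
  also have "\<dots> \<le> 2 powr (p - 1) * (T + T)"
    using u v by (intro mult_left_mono add_mono) auto
  also have "\<dots> = 2 powr p * T"
    by (simp add: powr_diff)
  finally have "lp_dist p u v \<le> (2 powr p * T) powr (1 / p)"
    using p suv unfolding lp_dist_def lp_norm_def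
    by (intro powr_mono2 suminf_nonneg) auto
  also have "\<dots> = 2 * T powr (1 / p)"
    using p T by (simp add: powr_mult powr_powr)
  finally show ?thesis .
qed

section \<open>Distortion and volume distribution\<close>

lemma finite_pair_image: "finite X \<Longrightarrow> finite {g x y | x y. x \<in> X \<and> y \<in> X \<and> P x y}"
  by (rule finite_subset[of _ "(\<lambda>(x, y). g x y) ` (X \<times> X)"]) auto

lemma dist_le_diam:
  assumes "finite A" "x \<in> A" "y \<in> A"
  shows "d x y \<le> diam d A"
  unfolding diam_def using assms finite_pair_image[of A d "\<lambda>_ _. True"]
  by (intro Max_ge) auto

lemma diam_le:
  assumes "finite A" "A \<noteq> {}" "\<And>x y. x \<in> A \<Longrightarrow> y \<in> A \<Longrightarrow> d x y \<le> r"
  shows "diam d A \<le> r"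
proof -
  have "{d x y | x y. x \<in> A \<and> y \<in> A} \<noteq> {}"
    using assms(2) by blast
  then show ?thesis
    unfolding diam_def using assms(1,3) finite_pair_image[of A d "\<lambda>_ _. True"]
    by (subst Max_le_iff) auto
qed

lemma finite_volume_ratios:
  "finite X \<Longrightarrow> finite {diam d A / diam d X | A. A \<subseteq> X \<and> P A}"
  by (rule finite_subset[of _ "(\<lambda>A. diam d A / diam d X) ` Pow X"]) auto

lemma volume_distribution_le:
  assumes "finite X" "A \<subseteq> X" "real (card A) \<ge> \<epsilon> * real (card X)"
  shows "volume_distribution \<epsilon> X d \<le> diam d A / diam d X"
  unfolding volume_distribution_def
  using assms finite_volume_ratios by (intro Min_le) auto

lemma volume_distribution_nonneg:
  assumes X: "finite X" "X \<noteq> {}" and d: "\<And>x y. 0 \<le> d x y" and \<epsilon>: "0 < \<epsilon>" "\<epsilon> \<le> 1"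
  shows "0 \<le> volume_distribution \<epsilon> X d"
proof -
  have pos: "0 \<le> diam d A" if A: "finite A" "A \<noteq> {}" for A
  proof -
    obtain x where "x \<in> A"
      using A(2) by blast
    then show ?thesis
      using dist_le_diam[OF A(1), of x x d] d[of x x] by linarith
  qed
  have "0 \<le> diam d A / diam d X" if "A \<subseteq> X" "\<epsilon> * real (card X) \<le> real (card A)" for A
  proof -
    have "0 < \<epsilon> * real (card X)"
      using X \<epsilon> by (simp add: card_gt_0_iff)
    with that have "A \<noteq> {}" by auto
    with that X show ?thesis
      by (intro divide_nonneg_nonneg pos) (auto intro: finite_subset[OF _ X(1)])
  qed
  moreover have "\<epsilon> * real (card X) \<le> real (card X)"
    using \<epsilon> by (simp add: mult_left_le_one_le)
  ultimately show ?thesis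
    unfolding volume_distribution_def using finite_volume_ratios[OF X(1)]
    by (subst Min_ge_iff) auto
qed

lemma dist_le_expansion:
  assumes X: "finite X" "x \<in> X" "y \<in> X" "x \<noteq> y" and p: "1 \<le> p"
    and f: "f \<in> lp_embeddings p X d"
  shows "d x y \<le> expansion p X d f * lp_dist p (f x) (f y)"
    and "0 < d x y" and "0 < expansion p X d f"
proof -
  have pos: "0 < lp_dist p (f x) (f y)"
    using X f by (intro lp_dist_pos[OF p]) (auto simp: lp_embeddings_def inj_on_def)
  have le: "d x y / lp_dist p (f x) (f y) \<le> expansion p X d f"
    unfolding expansion_def
    using X finite_pair_image[of X "\<lambda>x y. d x y / lp_dist p (f x) (f y)" "\<lambda>x y. x \<noteq> y"]
    by (intro Max_ge) auto
  with pos show "d x y \<le> expansion p X d f * lp_dist p (f x) (f y)"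
    by (simp add: field_simps)
  show d: "0 < d x y"
    using pos X f by (auto simp: lp_embeddings_def intro: less_le_trans)
  show "0 < expansion p X d f"
    using le pos d by (meson divide_pos_pos less_le_trans)
qed

text \<open>
  The infimum in the distortion is of no use if there are no embeddings. Points at distance at least
  1 from each other embed already into a line, on equidistant points of the unit interval.
\<close>

lemma lp_embeddings_nonempty:
  assumes X: "finite X" and p: "1 \<le> p" and d0: "\<And>x y. 0 \<le> d x y"
    and d1: "\<And>x y. x \<in> X \<Longrightarrow> y \<in> X \<Longrightarrow> x \<noteq> y \<Longrightarrow> 1 \<le> d x y"
  shows "lp_embeddings p X d \<noteq> {}"
proof -
  obtain h where h: "bij_betw h X {0..<card X}"
    using X ex_bij_betw_finite_nat by blast
  let ?c = "\<lambda>x. real (h x) / real (card X)"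
  let ?F = "\<lambda>x n. if n = 0 then ?c x else 0"
  have inj: "?c x \<noteq> ?c y" if "x \<in> X" "y \<in> X" "x \<noteq> y" for x y
    using h that X by (auto simp: bij_betw_def inj_on_def card_gt_0_iff)
  have c01: "0 \<le> ?c x \<and> ?c x \<le> 1" if "x \<in> X" for x
  proof -
    have "h x < card X"
      using h that by (auto simp: bij_betw_def)
    then show ?thesis by simp
  qed
  have line: "(\<lambda>n. \<bar>if n = 0 then t else (0::real)\<bar> powr p) sums (\<bar>t\<bar> powr p)" for t
    using sums_single[of 0 "\<lambda>_. \<bar>t\<bar> powr p"] by (rule back_subst[where P = "\<lambda>f. f sums _"]) auto
  have norm: "lp_norm p (\<lambda>n. if n = 0 then t else 0) = \<bar>t\<bar>" for t
    unfolding lp_norm_def sums_unique[OF line, symmetric] using p by (simp add: powr_powr)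
  have dist: "lp_dist p (?F x) (?F y) = \<bar>?c x - ?c y\<bar>" for x y
  proof -
    have diff: "(\<lambda>n. ?F x n - ?F y n) = (\<lambda>n. if n = 0 then ?c x - ?c y else 0)"
      by auto
    show ?thesis
      unfolding lp_dist_def diff by (rule norm)
  qed
  have "lp_dist p (?F x) (?F y) \<le> d x y" if "x \<in> X" "y \<in> X" for x y
  proof (cases "x = y")
    case True
    then show ?thesis using d0 unfolding dist by simp
  next
    case False
    have "\<bar>?c x - ?c y\<bar> \<le> 1"
      using c01[OF that(1)] c01[OF that(2)] by linarith
    then show ?thesis
      using d1[OF that False] unfolding dist by linarith
  qed
  moreover have "inj_on ?F X"
  proof (rule inj_onI, rule ccontr)
    fix x y assume "x \<in> X" "y \<in> X" "?F x = ?F y" "x \<noteq> y"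
    then show False
      using inj[of x y] fun_cong[of "?F x" "?F y" 0] by simp
  qed
  moreover have "?F ` X \<subseteq> lp_space p"
    using sums_summable[OF line] by (auto simp: lp_space_def)
  ultimately have "?F \<in> lp_embeddings p X d"
    unfolding lp_embeddings_def by blast
  then show ?thesis by blast
qed

section \<open>The distance of a graph\<close>

lemma graph_dist_nonneg: "0 \<le> graph_dist G x y"
  by (simp add: graph_dist_def)

lemma graph_dist_ge_1:
  assumes "connected_graph G" "x \<in> verts G" "y \<in> verts G" "x \<noteq> y"
  shows "1 \<le> graph_dist G x y"
proof -
  obtain n where "(adjacent G ^^ n) x y"
    using assms(1-3) unfolding connected_graph_def by blast
  then have path: "(adjacent G ^^ (LEAST n. (adjacent G ^^ n) x y)) x y"
    by (rule LeastI)
  have "(LEAST n. (adjacent G ^^ n) x y) \<noteq> 0"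
  proof
    assume zero: "(LEAST n. (adjacent G ^^ n) x y) = 0"
    have "(adjacent G ^^ 0) x y"
      using path unfolding zero .
    then show False
      using assms(4) by simp
  qed
  then show ?thesis
    unfolding graph_dist_def by linarith
qed

lemma graph_dist_adjacent_le:
  assumes "adjacent G x y"
  shows "graph_dist G x y \<le> 1"
proof -
  have "(LEAST n. (adjacent G ^^ n) x y) \<le> 1"
    using assms by (intro Least_le) (simp only: relpowp_1)
  then show ?thesis
    unfolding graph_dist_def by linarith
qed

lemma adjacent_in_verts: "finite_multigraph G \<Longrightarrow> adjacent G x y \<Longrightarrow> y \<in> verts G"
  unfolding adjacent_def finite_multigraph_def by blast

section \<open>Poincare inequalities\<close>

text \<open>
  Moving a number onto the interval spanned by the values brings it closer to each of them, so it
  suffices to minimise over this compact interval.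
\<close>

lemma best_constant_attained:
  fixes f :: "'a \<Rightarrow> real"
  assumes V: "finite V" and p: "1 \<le> p"
  obtains a where "\<And>b. (\<Sum>x\<in>V. \<bar>f x - a\<bar> powr p) \<le> (\<Sum>x\<in>V. \<bar>f x - b\<bar> powr p)"
proof (cases "V = {}")
  case True
  then show ?thesis using that by auto
next
  case False
  let ?g = "\<lambda>a. \<Sum>x\<in>V. \<bar>f x - a\<bar> powr p"
  let ?l = "Min (f ` V)" and ?u = "Max (f ` V)"
  have lu: "?l \<le> f x" "f x \<le> ?u" if "x \<in> V" for x
    using V that by auto
  obtain x0 where "x0 \<in> V"
    using False by blast
  then have le: "?l \<le> ?u"
    using lu[of x0] by linarith
  have "continuous_on {?l..?u} ?g"
    using p by (intro continuous_on_sum continuous_on_powr' continuous_intros) auto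
  then obtain a where a: "\<And>b. b \<in> {?l..?u} \<Longrightarrow> ?g a \<le> ?g b"
    using continuous_attains_inf[of "{?l..?u}" ?g] le by (metis atLeastatMost_empty_iff compact_Icc not_less)
  have "?g a \<le> ?g b" for b
  proof -
    let ?b = "max ?l (min ?u b)"
    have "?g a \<le> ?g ?b"
      using le by (intro a) auto
    also have "\<dots> \<le> ?g b"
    proof (intro sum_mono powr_mono2)
      fix x assume "x \<in> V"
      then show "\<bar>f x - ?b\<bar> \<le> \<bar>f x - b\<bar>"
        using lu[of x] by linarith
    qed (use p in auto)
    finally show ?thesis .
  qed
  then show ?thesis using that by blast
qed

lemma poincare:
  fixes G :: "('v, 'e) multigraph" and f :: "'v \<Rightarrow> real"
  assumes G: "finite_multigraph G" and p: "1 \<le> p"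
  obtains a where "spectral_gap p G * (\<Sum>x\<in>verts G. \<bar>f x - a\<bar> powr p)
    \<le> (\<Sum>x\<in>verts G. \<Sum>y | adjacent G x y. \<bar>f x - f y\<bar> powr p * real (edge_mult G x y))"
proof -
  let ?V = "verts G"
  let ?E = "\<lambda>f. \<Sum>x\<in>?V. \<Sum>y | adjacent G x y. \<bar>f x - f y\<bar> powr p * real (edge_mult G x y)"
  let ?S = "\<lambda>f a. \<Sum>x\<in>?V. \<bar>f x - a\<bar> powr p"
  let ?I = "\<lambda>f. INF a\<in>(UNIV::real set). ?S f a"
  have fin: "finite ?V"
    using G by (simp add: finite_multigraph_def)
  have E: "0 \<le> ?E f" for f
    by (intro sum_nonneg mult_nonneg_nonneg) auto
  have S: "0 \<le> ?S f a" for f a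
    by (intro sum_nonneg) auto
  have I: "0 \<le> ?I f" for f
    by (intro cINF_greatest S) auto
  obtain a where a: "\<And>b. ?S f a \<le> ?S f b"
    using best_constant_attained[OF fin p] by metis
  have Sa: "?I f = ?S f a"
  proof (rule antisym)
    show "?I f \<le> ?S f a"
      using S by (intro cINF_lower bdd_belowI[of _ 0]) auto
    show "?S f a \<le> ?I f"
      using a by (intro cINF_greatest) auto
  qed
  have "spectral_gap p G * ?S f a \<le> ?E f"
  proof (cases "\<exists>x\<in>?V. \<exists>y\<in>?V. f x \<noteq> f y")
    case True
    have "spectral_gap p G \<le> ?E f / ?I f"
      unfolding spectral_gap_def
      using True E I by (intro cINF_lower bdd_belowI[of _ 0]) auto
    then show ?thesis
      using E[of f] S[of f a] unfolding Sa
      by (cases "?S f a = 0") (auto simp: pos_le_divide_eq less_le)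
  next
    case False
    \<comment> \<open>The infimum defining the gap excludes constant functions, but these have variation 0.\<close>
    then obtain c where c: "\<And>x. x \<in> ?V \<Longrightarrow> f x = c"
      by metis
    have "?S f a \<le> ?S f c" by (rule a)
    also have "\<dots> = 0"
      using c by (intro sum.neutral) auto
    finally have "?S f a = 0"
      using S[of f a] by linarith
    then show ?thesis using E[of f] by simp
  qed
  then show ?thesis using that by blast
qed

text \<open>
  The sequence \<open>a\<close> is not known to be in \<open>\<ell>\<^sub>p\<close> beforehand; that \<open>F x - a\<close> is in \<open>\<ell>\<^sub>p\<close> comes out of
  the coordinatewise inequalities, and this is where positivity of the gap is used.
\<close>

lemma lp_poincare:
  fixes G :: "('v, 'e) multigraph" and F :: "'v \<Rightarrow> nat \<Rightarrow> real"
  assumes G: "finite_multigraph G" and p: "1 \<le> p"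
    and F: "F ` verts G \<subseteq> lp_space p" and gap: "0 < spectral_gap p G"
  obtains a where "\<And>x. x \<in> verts G \<Longrightarrow> summable (\<lambda>n. \<bar>F x n - a n\<bar> powr p)"
    and "spectral_gap p G * (\<Sum>x\<in>verts G. \<Sum>n. \<bar>F x n - a n\<bar> powr p)
      \<le> (\<Sum>x\<in>verts G. \<Sum>y | adjacent G x y.
            lp_dist p (F x) (F y) powr p * real (edge_mult G x y))"
proof -
  let ?V = "verts G" and ?gap = "spectral_gap p G"
  let ?e = "\<lambda>x y n. \<bar>F x n - F y n\<bar> powr p * real (edge_mult G x y)"
  let ?E = "\<lambda>n. \<Sum>x\<in>?V. \<Sum>y | adjacent G x y. ?e x y n"
  have fin: "finite ?V"
    using G by (simp add: finite_multigraph_def)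
  have "\<forall>n. \<exists>a. ?gap * (\<Sum>x\<in>?V. \<bar>F x n - a\<bar> powr p) \<le> ?E n"
  proof
    show "\<exists>a. ?gap * (\<Sum>x\<in>?V. \<bar>F x n - a\<bar> powr p) \<le> ?E n" for n
      by (rule poincare[OF G p, of "\<lambda>x. F x n"]) (rule exI)
  qed
  from choice[OF this] obtain a
    where a: "?gap * (\<Sum>x\<in>?V. \<bar>F x n - a n\<bar> powr p) \<le> ?E n" for n
    by blast
  have nb: "y \<in> ?V" if "y \<in> {y. adjacent G x y}" for x y
    using adjacent_in_verts[OF G] that by blast
  have sd: "summable (\<lambda>n. \<bar>F x n - F y n\<bar> powr p)" if "x \<in> ?V" "y \<in> ?V" for x y
    using F that by (intro summable_abs_diff_powr p) (auto simp: lp_space_def)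
  have se: "summable (?e x y)" if "x \<in> ?V" "y \<in> {y. adjacent G x y}" for x y
    using sd[OF that(1) nb[OF that(2)]] by (rule summable_mult2)
  have sE: "summable ?E"
    by (intro summable_sum se)
  have sa: "summable (\<lambda>n. \<bar>F x n - a n\<bar> powr p)" if x: "x \<in> ?V" for x
  proof (rule summable_comparison_test')
    show "summable (\<lambda>n. inverse ?gap * ?E n)"
      by (intro summable_mult sE)
    fix n :: nat
    have "\<bar>F x n - a n\<bar> powr p \<le> (\<Sum>x\<in>?V. \<bar>F x n - a n\<bar> powr p)"
      using fin x by (intro member_le_sum) auto
    also have "\<dots> \<le> inverse ?gap * ?E n"
      using a[of n] gap by (simp add: field_simps)
    finally show "norm (\<bar>F x n - a n\<bar> powr p) \<le> inverse ?gap * ?E n"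
      by simp
  qed
  have "?gap * (\<Sum>x\<in>?V. \<Sum>n. \<bar>F x n - a n\<bar> powr p)
      = (\<Sum>n. ?gap * (\<Sum>x\<in>?V. \<bar>F x n - a n\<bar> powr p))"
    by (simp add: suminf_sum[OF sa] suminf_mult[OF summable_sum[OF sa]])
  also have "\<dots> \<le> suminf ?E"
    by (intro suminf_le a summable_mult summable_sum sa sE)
  also have "\<dots> = (\<Sum>x\<in>?V. \<Sum>y | adjacent G x y. suminf (?e x y))"
    by (subst suminf_sum, intro summable_sum se, assumption+, intro sum.cong refl suminf_sum se)
  also have "\<dots> = (\<Sum>x\<in>?V. \<Sum>y | adjacent G x y.
      lp_dist p (F x) (F y) powr p * real (edge_mult G x y))"
  proof (intro sum.cong refl)
    fix x y assume xy: "x \<in> ?V" "y \<in> {y. adjacent G x y}"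
    have "lp_dist p (F x) (F y) powr p = (\<Sum>n. \<bar>F x n - F y n\<bar> powr p)"
      using F xy nb by (intro lp_dist_powr p) auto
    then show "suminf (?e x y) = lp_dist p (F x) (F y) powr p * real (edge_mult G x y)"
      using suminf_mult2[OF sd[OF xy(1) nb[OF xy(2)]]] by simp
  qed
  finally show ?thesis
    using that sa by blast
qed

section \<open>Large sets with small image\<close>

lemma markov_count:
  fixes v :: "'a \<Rightarrow> real"
  assumes V: "finite V" "V \<noteq> {}" and \<epsilon>: "\<epsilon> < 1"
    and v: "\<And>x. x \<in> V \<Longrightarrow> 0 \<le> v x" and T: "0 \<le> T"
    and le: "sum v V \<le> real (card V) * ((1 - \<epsilon>) * T)"
  shows "\<epsilon> * real (card V) \<le> real (card {x\<in>V. v x \<le> T})"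
proof (rule ccontr)
  let ?A = "{x\<in>V. v x \<le> T}" and ?B = "{x\<in>V. T < v x}"
  assume "\<not> ?thesis"
  moreover have "card V = card ?A + card ?B"
    using V by (subst card_Un_disjoint[symmetric]) (auto intro: arg_cong[where f = card])
  ultimately have B: "(1 - \<epsilon>) * real (card V) < real (card ?B)"
    by (simp add: algebra_simps)
  have "0 < (1 - \<epsilon>) * real (card V)"
    using V \<epsilon> by (simp add: card_gt_0_iff)
  \<comment> \<open>The threshold \<open>T\<close> may be 0, so the strict inequality has to come from the sum over \<open>?B\<close>,
      which is strict because \<open>?B\<close> is not empty.\<close>
  with B have "0 < card ?B"
    by linarith
  then have "?B \<noteq> {}"
    unfolding card_gt_0_iff by blast
  then have "(\<Sum>x\<in>?B. T) < sum v ?B"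
    using V by (intro sum_strict_mono) auto
  also have "\<dots> \<le> sum v V"
    using V v by (intro sum_mono2) auto
  also note le
  also have "real (card V) * ((1 - \<epsilon>) * T) \<le> real (card ?B) * T"
    using mult_right_mono[OF less_imp_le[OF B] T] by (simp add: algebra_simps)
  finally show False by simp
qed

text \<open>
  The mean over the vertices of the \<open>p\<close>-th power of the distance to the centre is at most
  \<open>k / spectral_gap p G\<close>: each edge has an image of length at most 1, and the multiplicities at a
  vertex add up to its degree. Markov's inequality does the rest.
\<close>

lemma many_vertices_near_centre:
  fixes G :: "('v, 'e) multigraph" and F :: "'v \<Rightarrow> nat \<Rightarrow> real"
  assumes G: "finite_multigraph G" "verts G \<noteq> {}"
    and deg: "\<forall>x\<in>verts G. vertex_degree G x \<le> k"
    and p: "1 \<le> p" and \<epsilon>: "\<epsilon> < 1" and gap: "0 < spectral_gap p G"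
    and F: "F \<in> lp_embeddings p (verts G) (graph_dist G)"
  obtains A where "A \<subseteq> verts G" and "\<epsilon> * real (card (verts G)) \<le> real (card A)"
    and "\<And>x y. x \<in> A \<Longrightarrow> y \<in> A \<Longrightarrow>
      lp_dist p (F x) (F y) \<le> 2 * (real k / (spectral_gap p G * (1 - \<epsilon>))) powr (1 / p)"
proof -
  let ?V = "verts G" and ?gap = "spectral_gap p G"
  let ?T = "real k / (?gap * (1 - \<epsilon>))"
  have fin: "finite ?V"
    using G by (simp add: finite_multigraph_def)
  have Flp: "F ` ?V \<subseteq> lp_space p"
    using F by (simp add: lp_embeddings_def)
  obtain a where sa: "\<And>x. x \<in> ?V \<Longrightarrow> summable (\<lambda>n. \<bar>F x n - a n\<bar> powr p)"
    and a: "?gap * (\<Sum>x\<in>?V. \<Sum>n. \<bar>F x n - a n\<bar> powr p)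
      \<le> (\<Sum>x\<in>?V. \<Sum>y | adjacent G x y. lp_dist p (F x) (F y) powr p * real (edge_mult G x y))"
    using lp_poincare[OF G(1) p Flp gap] by blast
  let ?v = "\<lambda>x. \<Sum>n. \<bar>F x n - a n\<bar> powr p"
  let ?A = "{x\<in>?V. ?v x \<le> ?T}"
  note a
  also have "(\<Sum>x\<in>?V. \<Sum>y | adjacent G x y. lp_dist p (F x) (F y) powr p * real (edge_mult G x y))
      \<le> (\<Sum>x\<in>?V. \<Sum>y | adjacent G x y. 1 * real (edge_mult G x y))"
  proof (intro sum_mono mult_right_mono)
    fix x y assume xy: "x \<in> ?V" "y \<in> {y. adjacent G x y}"
    have "lp_dist p (F x) (F y) \<le> graph_dist G x y"
      using F xy adjacent_in_verts[OF G(1)] by (auto simp: lp_embeddings_def)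
    also have "\<dots> \<le> 1"
      using xy by (intro graph_dist_adjacent_le) simp
    finally show "lp_dist p (F x) (F y) powr p \<le> 1"
      using powr_mono2[of p "lp_dist p (F x) (F y)" 1] p lp_dist_nonneg by simp
  qed auto
  also have "\<dots> = (\<Sum>x\<in>?V. real (vertex_degree G x))"
    by (simp add: vertex_degree_def)
  also have "\<dots> \<le> real (card ?V) * real k"
    using deg by (intro sum_bounded_above) auto
  finally have "sum ?v ?V \<le> real (card ?V) * (real k / ?gap)"
    using gap by (simp add: field_simps)
  also have "real k / ?gap = (1 - \<epsilon>) * ?T"
    using \<epsilon> by simp
  finally have "sum ?v ?V \<le> real (card ?V) * ((1 - \<epsilon>) * ?T)" .
  then have "\<epsilon> * real (card ?V) \<le> real (card ?A)"
    using fin G(2) \<epsilon> gap sa by (intro markov_count) (auto intro: suminf_nonneg)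
  moreover have "lp_dist p (F x) (F y) \<le> 2 * ?T powr (1 / p)" if "x \<in> ?A" "y \<in> ?A" for x y
    using that sa by (intro lp_dist_le_twice_radius[OF p, of _ a]) auto
  ultimately show ?thesis
    using that[of ?A] by blast
qed

text \<open>
  The estimate is kept linear in the distortion: the infimum over embeddings commutes with
  multiplication by a positive constant, and \<open>p\<close>-th powers are taken only afterwards. A gap that is
  not positive satisfies the bound of the theorem trivially.
\<close>

lemma volume_diam_le_distortion:
  fixes G :: "('v, 'e) multigraph"
  assumes G: "finite_multigraph G" "connected_graph G" "2 \<le> card (verts G)"
    and deg: "\<forall>x\<in>verts G. vertex_degree G x \<le> k"
    and p: "1 \<le> p" and \<epsilon>: "0 < \<epsilon>" "\<epsilon> < 1" and gap: "0 < spectral_gap p G"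
    and \<rho>: "graph_volume_distribution \<epsilon> G \<noteq> 0"
  shows "graph_volume_distribution \<epsilon> G * graph_diam G
    \<le> 2 * (real k / (spectral_gap p G * (1 - \<epsilon>))) powr (1 / p) * graph_lp_distortion p G"
    and "0 < graph_volume_distribution \<epsilon> G" and "0 < graph_diam G"
proof -
  let ?V = "verts G" and ?d = "graph_dist G" and ?\<rho> = "graph_volume_distribution \<epsilon> G"
  let ?R = "2 * (real k / (spectral_gap p G * (1 - \<epsilon>))) powr (1 / p)"
  have fin: "finite ?V" and ne: "?V \<noteq> {}"
    using G by (auto simp: finite_multigraph_def)
  obtain x0 y0 where xy0: "x0 \<in> ?V" "y0 \<in> ?V" "x0 \<noteq> y0"
    using G(3) card_le_Suc0_iff_eq[OF fin] by fastforce
  show D: "0 < graph_diam G"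
    using graph_dist_ge_1[OF G(2) xy0] dist_le_diam[OF fin xy0(1,2), of ?d]
    by (simp add: graph_diam_def)
  show \<rho>0: "0 < ?\<rho>"
    using \<rho> volume_distribution_nonneg[OF fin ne, of ?d \<epsilon>] graph_dist_nonneg \<epsilon>
    by (fastforce simp: graph_volume_distribution_def less_le)
  have main: "?\<rho> * graph_diam G \<le> expansion p ?V ?d F * ?R" if F: "F \<in> lp_embeddings p ?V ?d" for F
  proof -
    obtain A where A: "A \<subseteq> ?V" "\<epsilon> * real (card ?V) \<le> real (card A)"
      and R: "\<And>x y. x \<in> A \<Longrightarrow> y \<in> A \<Longrightarrow> lp_dist p (F x) (F y) \<le> ?R"
      using many_vertices_near_centre[OF G(1) ne deg p \<epsilon>(2) gap F] by blast
    note L = dist_le_expansion[OF fin _ _ _ p F]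
    have "0 < \<epsilon> * real (card ?V)"
      using \<epsilon> fin ne by (simp add: card_gt_0_iff)
    with A(2) have Ane: "A \<noteq> {}" by auto
    have "?\<rho> * graph_diam G \<le> diam ?d A"
      using volume_distribution_le[OF fin A, of ?d] D
      by (simp add: graph_volume_distribution_def graph_diam_def field_simps)
    also have "\<dots> \<le> expansion p ?V ?d F * ?R"
    proof (rule diam_le)
      fix x y assume xy: "x \<in> A" "y \<in> A"
      have L0: "0 < expansion p ?V ?d F"
        using L(3)[OF xy0] .
      show "?d x y \<le> expansion p ?V ?d F * ?R"
      proof (cases "x = y")
        case True
        have "?d x x = 0"
          by (simp add: graph_dist_def Least_eq_0)
        with True L0 show ?thesis by simp
      next
        case False
        then have "?d x y \<le> expansion p ?V ?d F * lp_dist p (F x) (F y)"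
          using L(1) xy A by blast
        also have "\<dots> \<le> expansion p ?V ?d F * ?R"
          using R[OF xy] L0 by (intro mult_left_mono) auto
        finally show ?thesis .
      qed
    qed (use A fin Ane finite_subset[OF A(1) fin] in auto)
    finally show ?thesis .
  qed
  have emb: "lp_embeddings p ?V ?d \<noteq> {}"
    using graph_dist_nonneg graph_dist_ge_1[OF G(2)] by (intro lp_embeddings_nonempty fin p) auto
  then obtain F0 where F0: "F0 \<in> lp_embeddings p ?V ?d" by blast
  \<comment> \<open>The product of \<open>?\<rho>\<close> and the diameter is positive, so \<open>?R\<close> does not vanish and can be divided
      out before the infimum is taken.\<close>
  have LR: "0 < expansion p ?V ?d F0 * ?R"
    using mult_pos_pos[OF \<rho>0 D] main[OF F0] by (rule less_le_trans)
  have R0: "0 < ?R"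
  proof (rule ccontr)
    assume "\<not> 0 < ?R"
    moreover have "0 \<le> ?R" by simp
    ultimately have "?R = 0" by linarith
    with LR show False by (simp only: mult_zero_right less_irrefl)
  qed
  have "?\<rho> * graph_diam G / ?R \<le> graph_lp_distortion p G"
    unfolding graph_lp_distortion_def lp_distortion_def
    using main R0 by (intro cINF_greatest emb) (simp only: pos_divide_le_eq)
  then show "?\<rho> * graph_diam G \<le> ?R * graph_lp_distortion p G"
    using R0 by (simp only: pos_divide_le_eq mult.commute)
qed

theorem theorem3:
  fixes G :: "('v, 'e) multigraph" and k :: nat and p \<epsilon> :: real
  assumes "finite_multigraph G"
    and "connected_graph G"
    and "card (verts G) \<ge> 2"
    and "\<forall>x\<in>verts G. vertex_degree G x \<le> k"
    and "1 \<le> p"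
    and "0 < \<epsilon>" and "\<epsilon> < 1"
  shows "ereal (spectral_gap p G) \<le>
    (let \<rho> = graph_volume_distribution \<epsilon> G in
     if \<rho> = 0 then \<infinity>
     else ereal (gap_constant (real k) \<epsilon> \<rho> p * (graph_lp_distortion p G / graph_diam G) powr p))"
proof -
  let ?\<rho> = "graph_volume_distribution \<epsilon> G" and ?gap = "spectral_gap p G"
  let ?D = "graph_diam G" and ?c = "graph_lp_distortion p G"
  have "?gap \<le> gap_constant (real k) \<epsilon> ?\<rho> p * (?c / ?D) powr p" if \<rho>: "?\<rho> \<noteq> 0"
  proof (cases "0 < ?gap")
    case False
    have "0 \<le> gap_constant (real k) \<epsilon> ?\<rho> p * (?c / ?D) powr p"
      using assms by (simp add: gap_constant_def)
    with False show ?thesis by linarith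
  next
    case True
    let ?T = "real k / (?gap * (1 - \<epsilon>))"
    note main = volume_diam_le_distortion[OF assms True \<rho>]
    have T: "0 \<le> ?T"
      using True assms by simp
    have "1 \<le> ?T powr (1 / p) * (2 / ?\<rho> * (?c / ?D))"
      using main by (simp add: field_simps)
    then have "1 powr p \<le> (?T powr (1 / p) * (2 / ?\<rho> * (?c / ?D))) powr p"
      using assms(5) by (intro powr_mono2) auto
    also have "\<dots> = (?T powr (1 / p)) powr p * ((2 / ?\<rho>) powr p * (?c / ?D) powr p)"
      by (subst powr_mult, subst powr_mult, rule refl)
    also have "(?T powr (1 / p)) powr p = ?T"
    proof -
      have "1 / p * p = 1"
        using assms(5) by simp
      then show ?thesis
        using powr_one[OF T] by (simp only: powr_powr)
    qed
    finally have "1 \<le> real k / (1 - \<epsilon>) * ((2 / ?\<rho>) powr p * (?c / ?D) powr p) / ?gap"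
      by (simp add: mult.commute)
    then have "?gap \<le> real k / (1 - \<epsilon>) * ((2 / ?\<rho>) powr p * (?c / ?D) powr p)"
      using True by (simp only: pos_le_divide_eq mult_1)
    then show ?thesis
      by (simp add: gap_constant_def mult.assoc)
  qed
  then show ?thesis
    by (simp add: Let_def)
qed

end
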